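(* Let $G$ be a finite POEC group and let $p$ be a prime dividing $|G|$ such that $G$ has a cyclic Sylow $p$-subgroup. Then $G$ is not perfect.
   Context: A group $G$ is said to have the POEC property (is a POEC group) if any two elements of prime order in $G$ commute with each other (the primes may be equal or different). A group $G$ is perfect if $G=G'$, where $G'$ is its commutator subgroup. *)

theory Defs
  imports "HOL-Algebra.Sylow" "HOL-Algebra.Elementary_Groups" "HOL-Algebra.Multiplicative_Group"
begin

text \<open>\<open>group.ord\<close> is 0 for elements of infinite order, so these are not of prime order.\<close>

definition POEC_group :: "('a, 'b) monoid_scheme \<Rightarrow> bool" where
  "POEC_group G \<longleftrightarrow> group G \<and>
     (\<forall>x \<in> carrier G. \<forall>y \<in> carrier G.
        prime (group.ord G x) \<and> prime (group.ord G y) \<longrightarrow>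
        x \<otimes>\<^bsub>G\<^esub> y = y \<otimes>\<^bsub>G\<^esub> x)"

definition perfect_group :: "('a, 'b) monoid_scheme \<Rightarrow> bool" where
  "perfect_group G \<longleftrightarrow> group G \<and> derived G (carrier G) = carrier G"

text \<open>Meaningful for finite \<open>G\<close> and prime \<open>p\<close> only.\<close>

definition sylow_subgroup :: "nat \<Rightarrow> 'a set \<Rightarrow> ('a, 'b) monoid_scheme \<Rightarrow> bool" where
  "sylow_subgroup p P G \<longleftrightarrow> subgroup P G \<and> card P = p ^ multiplicity p (order G)"

end

theory Submission
  imports Defs
begin

text \<open>
  Let \<open>P\<close> be a cyclic Sylow \<open>p\<close>-subgroup and \<open>x\<close> a generator of its subgroup of order \<open>p\<close>.
  The proof shows that in a perfect POEC group \<open>x\<close> would be central, and then that the transfer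
  homomorphism into \<open>P\<close> does not kill \<open>x\<close>, although a perfect group has no nontrivial
  homomorphism into an abelian group.

  Centrality: by the POEC property every conjugate \<open>y\<close> of \<open>x\<close> commutes with \<open>x\<close>, so it lies in
  the centralizer \<open>C\<close> of \<open>x\<close>, which contains the abelian group \<open>P\<close>. As \<open>p\<close> does not divide the
  index of \<open>P\<close> in \<open>C\<close>, the element \<open>y\<close> fixes a coset of \<open>P\<close> in \<open>C\<close>
  (\<open>conjugate_into_subgroup_of_coprime_index\<close>), so some conjugate of \<open>y\<close> under \<open>C\<close> lies in \<open>P\<close>
  and has order dividing \<open>p\<close>, which makes it a power of \<open>x\<close>. Conjugation by elements of \<open>C\<close>
  does not move powers of \<open>x\<close>, hence \<open>y\<close> itself is a power of \<open>x\<close>. Thus \<open>x\<close> generates a normal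
  subgroup; its automorphism group is abelian, so commutators centralize \<open>x\<close>
  (\<open>derived_centralizes_generator_of_normal_subgroup\<close>), and these generate a perfect group.

  Transfer: the transfer sends a central element of \<open>P\<close> to its power by the index of \<open>P\<close>
  (\<open>transfer_of_central_element\<close>). That index is prime to \<open>p\<close>, so the image of \<open>x\<close> is nontrivial.
\<close>

section \<open>Actions of prime period\<close>

text \<open>
  The orbits of \<open>f\<close> have one or \<open>p\<close> elements, and a set without fixed points
  would be a disjoint union of orbits of the second kind.
\<close>

lemma fixpoint_of_prime_period:
  fixes f :: "'a \<Rightarrow> 'a"
  assumes p: "prime p"
    and "finite S" "f ` S \<subseteq> S" "\<And>s. s \<in> S \<Longrightarrow> (f ^^ p) s = s" "\<not> p dvd card S"
  shows "\<exists>s\<in>S. f s = s"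
  using assms(2-5)
proof (induction S rule: finite_psubset_induct)
  case (psubset S)
  show ?case
  proof (rule ccontr)
    assume nofix: "\<not> (\<exists>s\<in>S. f s = s)"
    have "S \<noteq> {}" using psubset.prems(3) by auto
    then obtain s where s: "s \<in> S" by blast
    have p0: "p > 0" using p prime_gt_0_nat by blast
    have per: "(f ^^ p) s = s" using psubset.prems(2) s by blast
    define Orb where "Orb = (\<lambda>i. (f ^^ i) s) ` {..<p}"
    have inS: "(f ^^ k) s \<in> S" for k
      using s psubset.prems(1) by (induction k) auto
    have inO: "(f ^^ k) s \<in> Orb" for k
    proof -
      have "(f ^^ k) s = (f ^^ (k mod p)) s" using funpow_mod_eq[OF per] by simp
      then show ?thesis using p0 by (auto simp: Orb_def)
    qed
    have distinct: "(f ^^ i) s \<noteq> (f ^^ j) s" if "i < j" "j < p" for i j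
    proof
      assume eq: "(f ^^ i) s = (f ^^ j) s"
      define d where "d = j - i"
      have "(f ^^ (p - i)) ((f ^^ i) s) = (f ^^ (p - i)) ((f ^^ j) s)" using eq by simp
      then have "(f ^^ p) s = (f ^^ (p + d)) s"
        using that by (simp add: funpow_add[symmetric, THEN fun_cong, simplified] d_def)
      then have d: "(f ^^ d) s = s"
        using per by (metis add.commute comp_apply funpow_add)
      have d': "0 < d" "d < p" using that by (auto simp: d_def)
      then have "coprime d p"
        using p by (metis coprime_commute nat_dvd_not_less prime_imp_coprime)
      \<comment> \<open>Both \<open>d\<close> and \<open>p\<close> are periods of \<open>s\<close>, hence so is their gcd 1.\<close>
      then obtain a b where ab: "d * a = p * b + 1"
        using bezout_nat[of d p] d' by (auto simp: coprime_iff_gcd_eq_1)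
      have "s = (f ^^ (d * a)) s" using funpow_mod_eq[OF d, of "d * a"] by simp
      also have "\<dots> = f ((f ^^ (p * b)) s)" using ab by simp
      also have "(f ^^ (p * b)) s = s" using funpow_mod_eq[OF per, of "p * b"] by simp
      finally show False using nofix s by auto
    qed
    have "inj_on (\<lambda>i. (f ^^ i) s) {..<p}"
      by (rule inj_onI) (metis distinct lessThan_iff linorder_neqE_nat)
    then have cO: "card Orb = p" by (simp add: Orb_def card_image)
    have OS: "Orb \<subseteq> S" using inS by (auto simp: Orb_def)
    have "card S = card (S - Orb) + p"
      using cO OS psubset.hyps by (metis card_Diff_subset card_mono finite_subset le_add_diff_inverse2)
    then have nd: "\<not> p dvd card (S - Orb)" using psubset.prems(3) by auto
    have im: "f ` (S - Orb) \<subseteq> S - Orb"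
    proof clarify
      fix t assume t: "t \<in> S" "t \<notin> Orb"
      have "f t \<notin> Orb"
      proof
        assume "f t \<in> Orb"
        then obtain i where i: "f t = (f ^^ i) s" by (auto simp: Orb_def)
        have "t = (f ^^ (p - 1)) (f t)"
          using psubset.prems(2)[OF t(1)] p0
          by (metis Suc_diff_1 comp_apply funpow_Suc_right)
        also have "\<dots> = (f ^^ (p - 1 + i)) s" by (simp add: i funpow_add)
        finally show False using inO t by metis
      qed
      then show "f t \<in> S - Orb" using t psubset.prems(1) by auto
    qed
    have "S - Orb \<subset> S" using inO[of 0] s by auto
    from psubset.IH[OF this im _ nd] psubset.prems(2) nofix show False by auto
  qed
qed

text \<open>The element \<open>y\<close> permutes the cosets \<open>P #> t\<close>, and a coset that it fixes gives \<open>t\<close>.\<close>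

lemma (in group) conjugate_into_subgroup_of_coprime_index:
  assumes P: "subgroup P G" and fin: "finite (carrier G)" and p: "prime p"
    and index: "\<not> p dvd card (rcosets P)"
    and y: "y \<in> carrier G" "y [^] p = \<one>"
  shows "\<exists>t\<in>carrier G. t \<otimes> y \<otimes> inv t \<in> P"
proof -
  have PG: "P \<subseteq> carrier G" using P subgroup.subset by blast
  let ?f = "\<lambda>C. C #> y"
  have iter: "(?f ^^ n) (P #> t) = P #> (t \<otimes> y [^] n)" if t: "t \<in> carrier G" for t and n :: nat
    by (induction n) (use t y PG in \<open>auto simp: coset_mult_assoc m_assoc\<close>)
  have "finite (rcosets P)"
    using P fin by (meson finite_Pow_iff finite_subset rcosets_subset_PowG)
  moreover have "?f ` (rcosets P) \<subseteq> rcosets P"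
    using PG y by (auto simp: RCOSETS_def coset_mult_assoc)
  moreover have "(?f ^^ p) C = C" if "C \<in> rcosets P" for C
    using that iter y PG by (auto simp: RCOSETS_def)
  ultimately obtain C where C: "C \<in> rcosets P" "C #> y = C"
    using fixpoint_of_prime_period[OF p, of "rcosets P" ?f] index by blast
  then obtain t where t: "t \<in> carrier G" "C = P #> t" by (auto simp: RCOSETS_def)
  have "t \<otimes> y \<in> P #> t"
    using C t y PG P by (metis coset_mult_assoc m_closed rcos_self)
  then have "t \<otimes> y \<otimes> inv t \<in> P"
    using subgroup.rcos_module_imp[OF P is_group t(1)] by blast
  then show ?thesis using t by blast
qed

section \<open>Elements of prime order in cyclic groups\<close>

text \<open>
  For a generator \<open>z\<close> the element is \<open>z [^] (order G div p)\<close>: a power \<open>z [^] b\<close> is killed by \<open>p\<close>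
  exactly if \<open>order G div p\<close> divides \<open>b\<close>.
\<close>

lemma (in group) cyclic_group_prime_torsion:
  assumes cyc: "cyclic_group G" and fin: "finite (carrier G)" and p: "prime p"
    and dvd: "p dvd order G"
  shows "\<exists>x\<in>carrier G. ord x = p \<and>
    (\<forall>u\<in>carrier G. u [^] p = \<one> \<longrightarrow> (\<exists>k::nat. u = x [^] k))"
proof -
  obtain z where z: "z \<in> carrier G" "carrier G = range (\<lambda>n::int. z [^] n)"
    using cyc cyclic_group by blast
  then have gen: "generate G {z} = carrier G" using generate_pow by auto
  then have n: "ord z = order G" using generate_pow_card[OF z(1)] by (simp add: order_def)
  obtain k where k: "order G = p * k" using dvd by blast
  have k0: "k > 0" using k fin order_gt_0_iff_finite by (metis gr0I mult_0_right)
  have p0: "p > 0" using p prime_gt_0_nat by blast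
  define x where "x = z [^] k"
  have x: "x \<in> carrier G" "ord x = p"
    using z(1) k n k0 ord_pow[of z k] by (auto simp: x_def)
  moreover have "\<exists>j::nat. u = x [^] j" if u: "u \<in> carrier G" "u [^] p = \<one>" for u
  proof -
    obtain b :: nat where b: "u = z [^] b"
      using u gen generate_pow_on_finite_carrier[OF fin z(1)] by blast
    then have "z [^] (b * p) = \<one>" using u z by (simp add: nat_pow_pow)
    then have "p * k dvd b * p" using pow_eq_id z n k by auto
    then have "k dvd b" using p0 by (simp add: mult.commute)
    then obtain j where "b = k * j" by blast
    then have "u = x [^] j" using b z by (simp add: x_def nat_pow_pow)
    then show ?thesis by blast
  qed
  ultimately show ?thesis by blast
qed

section \<open>Centralizers\<close>

lemma (in group) inv_mult_cancel_left:
  assumes "a \<in> carrier G" "b \<in> carrier G"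
  shows "inv a \<otimes> (a \<otimes> b) = b" "a \<otimes> (inv a \<otimes> b) = b"
  using assms by (simp_all flip: m_assoc)

lemma (in group) subgroup_centralizer:
  assumes x: "x \<in> carrier G"
  shows "subgroup {g \<in> carrier G. g \<otimes> x = x \<otimes> g} G"
proof (rule subgroupI)
  fix a b assume "a \<in> {g \<in> carrier G. g \<otimes> x = x \<otimes> g}" "b \<in> {g \<in> carrier G. g \<otimes> x = x \<otimes> g}"
  then show "a \<otimes> b \<in> {g \<in> carrier G. g \<otimes> x = x \<otimes> g}"
    using x by simp (metis m_assoc)
next
  fix a assume "a \<in> {g \<in> carrier G. g \<otimes> x = x \<otimes> g}"
  then show "inv a \<in> {g \<in> carrier G. g \<otimes> x = x \<otimes> g}"
    using x by simp (metis inv_closed inv_solve_left inv_solve_right m_closed m_assoc)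
qed (use x in auto)

lemma (in group) conjugate_pow:
  assumes "g \<in> carrier G" "x \<in> carrier G"
  shows "(g \<otimes> x \<otimes> inv g) [^] (n::nat) = g \<otimes> x [^] n \<otimes> inv g"
proof (induction n)
  case (Suc n)
  then show ?case using assms by (simp add: m_assoc inv_mult_cancel_left)
qed (use assms in auto)

text \<open>
  Conjugations act on the cyclic group generated by \<open>x\<close> by raising to powers, and such maps commute:
  conjugating \<open>x\<close> by \<open>g \<otimes> h\<close> and by \<open>h \<otimes> g\<close> gives the same result.
\<close>

lemma (in group) derived_centralizes_generator_of_normal_subgroup:
  assumes x: "x \<in> carrier G"
    and conj: "\<And>g. g \<in> carrier G \<Longrightarrow> \<exists>k::nat. g \<otimes> x \<otimes> inv g = x [^] k"
  shows "derived G (carrier G) \<subseteq> {g \<in> carrier G. g \<otimes> x = x \<otimes> g}"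
proof -
  have swap: "(g \<otimes> h) \<otimes> x \<otimes> inv (g \<otimes> h) = (h \<otimes> g) \<otimes> x \<otimes> inv (h \<otimes> g)"
    if g: "g \<in> carrier G" and h: "h \<in> carrier G" for g h
  proof -
    obtain i j :: nat where i: "g \<otimes> x \<otimes> inv g = x [^] i" and j: "h \<otimes> x \<otimes> inv h = x [^] j"
      using conj g h by meson
    have "(g \<otimes> h) \<otimes> x \<otimes> inv (g \<otimes> h) = g \<otimes> (h \<otimes> x \<otimes> inv h) \<otimes> inv g"
      using g h x by (simp add: m_assoc inv_mult_group)
    also have "\<dots> = x [^] (i * j)"
      using i j conjugate_pow[OF g x, of j] x by (simp add: nat_pow_pow)
    also have "\<dots> = h \<otimes> (g \<otimes> x \<otimes> inv g) \<otimes> inv h"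
      using i j conjugate_pow[OF h x, of i] x by (simp add: nat_pow_pow mult.commute)
    also have "\<dots> = (h \<otimes> g) \<otimes> x \<otimes> inv (h \<otimes> g)"
      using g h x by (simp add: m_assoc inv_mult_group)
    finally show ?thesis .
  qed
  have "a \<otimes> b \<otimes> inv a \<otimes> inv b \<in> {g \<in> carrier G. g \<otimes> x = x \<otimes> g}"
    if a: "a \<in> carrier G" and b: "b \<in> carrier G" for a b
  proof -
    let ?c = "inv a \<otimes> inv b" and ?d = "inv b \<otimes> inv a"
    have cd: "?c \<in> carrier G" "?d \<in> carrier G" using a b by auto
    have e: "?c \<otimes> x \<otimes> inv ?c = ?d \<otimes> x \<otimes> inv ?d" using swap a b by simp
    have "inv ?d \<otimes> ?c \<otimes> x = inv ?d \<otimes> (?c \<otimes> x \<otimes> inv ?c) \<otimes> ?c"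
      using cd x by (simp add: m_assoc)
    also have "\<dots> = x \<otimes> (inv ?d \<otimes> ?c)"
      unfolding e using cd x by (simp add: m_assoc inv_mult_cancel_left)
    finally have "inv ?d \<otimes> ?c \<otimes> x = x \<otimes> (inv ?d \<otimes> ?c)" .
    moreover have "inv ?d \<otimes> ?c = a \<otimes> b \<otimes> inv a \<otimes> inv b"
      using a b by (simp add: inv_mult_group m_assoc)
    ultimately show ?thesis using a b by simp
  qed
  then have "derived_set G (carrier G) \<subseteq> {g \<in> carrier G. g \<otimes> x = x \<otimes> g}" by blast
  then show ?thesis
    unfolding derived_def using generate_subgroup_incl subgroup_centralizer[OF x] by blast
qed

lemma (in group) sylow_index_in_intermediate_subgroup:
  assumes fin: "finite (carrier G)" and p: "prime p" and syl: "sylow_subgroup p P G"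
    and C: "subgroup C G" "P \<subseteq> C"
  shows "\<not> p dvd card (rcosets\<^bsub>G\<lparr>carrier := C\<rparr>\<^esub> P)"
proof
  assume dvd: "p dvd card (rcosets\<^bsub>G\<lparr>carrier := C\<rparr>\<^esub> P)"
  have P: "subgroup P G" and cP: "card P = p ^ multiplicity p (order G)"
    using syl by (auto simp: sylow_subgroup_def)
  interpret C: group "G\<lparr>carrier := C\<rparr>" using C subgroup_imp_group by blast
  have "card (rcosets\<^bsub>G\<lparr>carrier := C\<rparr>\<^esub> P) * card P = card C"
    using C.lagrange[of P] P C subgroup_incl by (simp add: order_def)
  then have "p ^ Suc (multiplicity p (order G)) dvd card C"
    using dvd cP by (metis dvd_refl mult_dvd_mono power_Suc)
  also have "card C dvd order G" using lagrange[OF C(1)] by (metis dvd_triv_right)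
  finally have "Suc (multiplicity p (order G)) \<le> multiplicity p (order G)"
    using p fin order_gt_0_iff_finite by (intro multiplicity_geI) (auto dest: prime_gt_1_nat)
  then show False by simp
qed

text \<open>
  In the centralizer of \<open>x\<close> the subgroup \<open>P\<close> still has index prime to \<open>p\<close>, so \<open>y\<close> can be moved into
  \<open>P\<close> by a conjugation that fixes the powers of \<open>x\<close>.
\<close>

lemma (in group) commuting_prime_torsion_is_power:
  assumes fin: "finite (carrier G)" and p: "prime p"
    and syl: "sylow_subgroup p P G" and comm: "comm_group (G\<lparr>carrier := P\<rparr>)"
    and x: "x \<in> P" and tors: "\<And>u. u \<in> P \<Longrightarrow> u [^] p = \<one> \<Longrightarrow> \<exists>k::nat. u = x [^] k"
    and y: "y \<in> carrier G" "y [^] p = \<one>" "y \<otimes> x = x \<otimes> y"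
  shows "\<exists>k::nat. y = x [^] k"
proof -
  have P: "subgroup P G" using syl by (simp add: sylow_subgroup_def)
  have xG: "x \<in> carrier G" using subgroup.mem_carrier[OF P x] .
  define C where "C = {g \<in> carrier G. g \<otimes> x = x \<otimes> g}"
  have C: "subgroup C G" using subgroup_centralizer[OF xG] by (simp add: C_def)
  have PC: "P \<subseteq> C"
  proof
    fix u assume u: "u \<in> P"
    have "u \<otimes> x = x \<otimes> u"
      using comm_monoid.m_comm[OF comm_group.axioms(1)[OF comm], of u x] u x by simp
    then show "u \<in> C" using u P subgroup.mem_carrier by (fastforce simp: C_def)
  qed
  let ?C = "G\<lparr>carrier := C\<rparr>"
  interpret C: group ?C using C subgroup_imp_group by blast
  have PsC: "subgroup P ?C" using P C PC subgroup_incl by blast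
  have finC: "finite (carrier ?C)" using fin C by (simp add: C_def)
  have idx: "\<not> p dvd card (rcosets\<^bsub>?C\<^esub> P)"
    using sylow_index_in_intermediate_subgroup[OF fin p syl C PC] .
  have yC: "y \<in> C" using y by (simp add: C_def)
  obtain t where t: "t \<in> C" "t \<otimes> y \<otimes> inv\<^bsub>?C\<^esub> t \<in> P"
    using C.conjugate_into_subgroup_of_coprime_index[OF PsC finC p idx, of y] yC y
    by (auto simp flip: nat_pow_consistent)
  have tG: "t \<in> carrier G" using t by (simp add: C_def)
  have tP: "t \<otimes> y \<otimes> inv t \<in> P" using t m_inv_consistent[OF C] by simp
  have "(t \<otimes> y \<otimes> inv t) [^] p = \<one>" using conjugate_pow[OF tG y(1)] y tG by simp
  then obtain k :: nat where k: "t \<otimes> y \<otimes> inv t = x [^] k" using tors tP by blast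
  have "x [^] k \<otimes> t = t \<otimes> x [^] k"
    using group_commutes_pow[of x t k] t xG by (simp add: C_def)
  moreover have "t \<otimes> y = x [^] k \<otimes> t" using k tG y xG by (metis inv_solve_right m_closed nat_pow_closed)
  ultimately have "y = x [^] k" using tG y xG by simp
  then show ?thesis by blast
qed

section \<open>Transfer into an abelian subgroup\<close>

text \<open>
  The homomorphism is the transfer: with a representative \<open>r C\<close> of every coset, an element \<open>g\<close> is
  sent to the product of the \<open>r C \<otimes> g \<otimes> inv (r (C #> g))\<close>. It is multiplicative because \<open>g\<close>
  permutes the cosets. For a central \<open>z \<in> P\<close> this permutation is trivial and all factors are \<open>z\<close>.
\<close>

lemma (in group) transfer_of_central_element:
  assumes P: "subgroup P G" and fin: "finite (carrier G)" and comm: "comm_group (G\<lparr>carrier := P\<rparr>)"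
    and z: "z \<in> P" and central: "\<And>g. g \<in> carrier G \<Longrightarrow> g \<otimes> z = z \<otimes> g"
  shows "\<exists>V\<in>hom G (G\<lparr>carrier := P\<rparr>). V z = z [^] card (rcosets P)"
proof -
  let ?P = "G\<lparr>carrier := P\<rparr>"
  interpret P: comm_group ?P by fact
  have PG: "P \<subseteq> carrier G" using P subgroup.subset by blast
  define r where "r C = (SOME t. t \<in> C)" for C :: "'a set"
  have rC: "r C \<in> C" if "C \<in> rcosets P" for C
    using subgroup.rcosets_non_empty[OF P that] by (auto simp: r_def intro: someI)
  have CG: "C \<subseteq> carrier G" if "C \<in> rcosets P" for C
    using rcosets_part_G[OF P] that by blast
  have rG: "r C \<in> carrier G" if "C \<in> rcosets P" for C using rC CG that by blast
  have Crep: "C = P #> r C" if "C \<in> rcosets P" for C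
    using that rC[OF that] repr_independence[OF _ _ P] by (auto simp: RCOSETS_def)
  have act: "C #> g \<in> rcosets P" if "C \<in> rcosets P" "g \<in> carrier G" for C g
    using that PG by (auto simp: RCOSETS_def coset_mult_assoc)
  define q where "q g C = r C \<otimes> g \<otimes> inv (r (C #> g))" for g C
  have qP: "q g C \<in> P" if C: "C \<in> rcosets P" and g: "g \<in> carrier G" for g C
  proof -
    have "r C \<otimes> g \<in> C #> g" using rC[OF C] by (auto simp: r_coset_def)
    then show ?thesis unfolding q_def
      using diff_neutralizes[OF P act[OF C g]] rC[OF act[OF C g]] by blast
  qed
  define V where "V g = finprod ?P (q g) (rcosets P)" for g
  have "V \<in> hom G ?P"
  proof (rule homI)
    fix g assume "g \<in> carrier G"
    then show "V g \<in> carrier ?P" unfolding V_def using qP by (intro P.finprod_closed) auto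
  next
    fix g h assume g: "g \<in> carrier G" and h: "h \<in> carrier G"
    have cocycle: "q (g \<otimes> h) C = q g C \<otimes> q h (C #> g)" if C: "C \<in> rcosets P" for C
    proof -
      have s: "r (C #> g) \<in> carrier G" "r (C #> g #> h) \<in> carrier G" "r C \<in> carrier G"
        using rG act C g h by auto
      show ?thesis
        unfolding q_def using s g h CG[OF C]
        by (simp add: m_assoc coset_mult_assoc inv_mult_cancel_left)
    qed
    have undo: "C #> g #> inv g = C" "C #> inv g #> g = C" if "C \<in> rcosets P" for C
      using CG[OF that] g by (auto simp: coset_mult_assoc)
    have inj_act: "inj_on (\<lambda>C. C #> g) (rcosets P)"
      by (rule inj_onI) (metis undo(1))
    have im_act: "(\<lambda>C. C #> g) ` (rcosets P) = rcosets P"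
    proof
      show "rcosets P \<subseteq> (\<lambda>C. C #> g) ` (rcosets P)"
        using undo(2) act g by (metis image_eqI inv_closed subsetI)
    qed (use act g in auto)
    have "V (g \<otimes> h) = finprod ?P (\<lambda>C. q g C \<otimes>\<^bsub>?P\<^esub> q h (C #> g)) (rcosets P)"
      unfolding V_def using qP act g h
      by (intro P.finprod_cong') (auto simp: cocycle intro: subgroup.m_closed[OF P])
    also have "\<dots> = V g \<otimes>\<^bsub>?P\<^esub> finprod ?P (\<lambda>C. q h (C #> g)) (rcosets P)"
      unfolding V_def using qP act g h by (intro P.finprod_multf) auto
    also have "finprod ?P (\<lambda>C. q h (C #> g)) (rcosets P) = V h"
      unfolding V_def using P.finprod_reindex[of "q h" "\<lambda>C. C #> g" "rcosets P"] inj_act qP h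
      by (simp add: im_act Pi_def)
    finally show "V (g \<otimes> h) = V g \<otimes>\<^bsub>?P\<^esub> V h" .
  qed
  moreover have "V z = z [^] card (rcosets P)"
  proof -
    have zG: "z \<in> carrier G" using z PG by blast
    have "q z C = z" if C: "C \<in> rcosets P" for C
    proof -
      have "C #> z = P #> z #> r C"
        using Crep[OF C] PG zG rG[OF C] central[OF rG[OF C]] by (metis coset_mult_assoc)
      then have "C #> z = C" using coset_join2[OF zG P z] Crep[OF C] by simp
      then show ?thesis
        unfolding q_def using central rG[OF C] zG by (simp add: m_assoc)
    qed
    then have "V z = finprod ?P (\<lambda>C. z) (rcosets P)"
      unfolding V_def using z by (intro P.finprod_cong') auto
    also have "\<dots> = z [^] card (rcosets P)"
      using P.finprod_const[of z] z nat_pow_consistent by simp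
    finally show ?thesis .
  qed
  ultimately show ?thesis by blast
qed

lemma hom_from_perfect_group_trivial:
  assumes perf: "perfect_group G" and H: "comm_group H" and h: "h \<in> hom G H"
    and g: "g \<in> carrier G"
  shows "h g = \<one>\<^bsub>H\<^esub>"
proof -
  interpret H: comm_group H by fact
  interpret group_hom G H h
    using perf h by (simp add: group_hom_def group_hom_axioms_def perfect_group_def)
  have "h ` carrier G = derived H (h ` carrier G)"
    using derived_img[of "carrier G"] perf by (simp add: perfect_group_def)
  also have "\<dots> = {\<one>\<^bsub>H\<^esub>}" by (rule H.derived_eq_singleton) auto
  finally show ?thesis using g by blast
qed

text \<open>
  The transfer into \<open>P\<close> raises \<open>x\<close> to a power prime to its order, so it is nontrivial.
\<close>

lemma (in group) not_perfect_if_abelian_sylow_has_central_prime_element: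
  assumes fin: "finite (carrier G)" and p: "prime p"
    and syl: "sylow_subgroup p P G" and comm: "comm_group (G\<lparr>carrier := P\<rparr>)"
    and x: "x \<in> P" "ord x = p" and central: "\<And>g. g \<in> carrier G \<Longrightarrow> g \<otimes> x = x \<otimes> g"
  shows "\<not> perfect_group G"
proof
  assume perf: "perfect_group G"
  have P: "subgroup P G" using syl by (simp add: sylow_subgroup_def)
  have xG: "x \<in> carrier G" using subgroup.mem_carrier[OF P x(1)] .
  obtain V where V: "V \<in> hom G (G\<lparr>carrier := P\<rparr>)" "V x = x [^] card (rcosets P)"
    using transfer_of_central_element[OF P fin comm x(1) central] by blast
  have "x [^] card (rcosets P) = \<one>"
    using hom_from_perfect_group_trivial[OF perf comm V(1) xG] V(2) by simp
  then have "p dvd card (rcosets P)" using pow_eq_id[OF xG] x(2) by simp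
  then show False
    using sylow_index_in_intermediate_subgroup[OF fin p syl subgroup_self] P subgroup.subset
    by force
qed

section \<open>Groups whose elements of prime order commute\<close>

lemma (in group) POEC_conjugate_is_power:
  assumes poec: "POEC_group G" and fin: "finite (carrier G)" and p: "prime p"
    and syl: "sylow_subgroup p P G" and comm: "comm_group (G\<lparr>carrier := P\<rparr>)"
    and x: "x \<in> P" "ord x = p"
    and tors: "\<And>u. u \<in> P \<Longrightarrow> u [^] p = \<one> \<Longrightarrow> \<exists>k::nat. u = x [^] k"
    and g: "g \<in> carrier G"
  shows "\<exists>k::nat. g \<otimes> x \<otimes> inv g = x [^] k"
proof -
  have P: "subgroup P G" using syl by (simp add: sylow_subgroup_def)
  have xG: "x \<in> carrier G" using subgroup.mem_carrier[OF P x(1)] .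
  let ?y = "g \<otimes> x \<otimes> inv g"
  have y: "?y \<in> carrier G" using g xG by simp
  have "?y [^] n = \<one> \<longleftrightarrow> p dvd n" for n :: nat
  proof -
    have "g \<otimes> x [^] n \<otimes> inv g = \<one> \<longleftrightarrow> x [^] n = \<one>"
      using g xG by (metis inv_solve_right' l_cancel_one l_one m_closed nat_pow_closed one_closed r_inv r_one)
    then show ?thesis using conjugate_pow[OF g xG, of n] pow_eq_id[OF xG] x(2) by simp
  qed
  then have ord_y: "ord ?y = p" using ord_unique[OF y] by blast
  then have "?y [^] p = \<one>" using pow_ord_eq_1[OF y] by simp
  moreover have "?y \<otimes> x = x \<otimes> ?y"
    using poec p ord_y x(2) xG y by (auto simp: POEC_group_def)
  ultimately show ?thesis
    using commuting_prime_torsion_is_power[OF fin p syl comm x(1) tors y] by blast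
qed

theorem theorem2p14:
  fixes G :: "('a, 'b) monoid_scheme" and p :: nat
  assumes "POEC_group G"
    and "finite (carrier G)"
    and "prime p"
    and "p dvd order G"
    and "\<exists>P. sylow_subgroup p P G \<and> cyclic_group (G\<lparr>carrier := P\<rparr>)"
  shows "\<not> perfect_group G"
proof
  assume perf: "perfect_group G"
  note poec = assms(1) and fin = assms(2) and p = assms(3)
  interpret group G using poec by (simp add: POEC_group_def)
  obtain P where syl: "sylow_subgroup p P G" and cyc: "cyclic_group (G\<lparr>carrier := P\<rparr>)"
    using assms(5) by blast
  let ?P = "G\<lparr>carrier := P\<rparr>"
  have P: "subgroup P G" and cP: "card P = p ^ multiplicity p (order G)"
    using syl by (auto simp: sylow_subgroup_def)
  interpret P: group ?P using P subgroup_imp_group by blast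
  have comm: "comm_group ?P" using P.cyclic_imp_abelian_group cyc by blast
  have PG: "P \<subseteq> carrier G" using P subgroup.subset by blast
  have "order G \<noteq> 0" using fin order_gt_0_iff_finite by simp
  then have "multiplicity p (order G) > 0"
    using assms(4) p by (simp add: prime_multiplicity_gt_zero_iff)
  then have "p dvd order ?P" using cP by (simp add: order_def)
  then obtain x where xP: "x \<in> P" and ordP: "P.ord x = p"
    and tors: "\<And>u. u \<in> P \<Longrightarrow> u [^]\<^bsub>G\<^esub> p = \<one>\<^bsub>G\<^esub> \<Longrightarrow> \<exists>k::nat. u = x [^]\<^bsub>G\<^esub> k"
    using P.cyclic_group_prime_torsion[OF cyc _ p] finite_subset[OF PG fin]
    by (auto simp flip: nat_pow_consistent)
  have x: "x \<in> carrier G" using xP PG by blast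
  have "x [^]\<^bsub>G\<^esub> n = \<one>\<^bsub>G\<^esub> \<longleftrightarrow> p dvd n" for n :: nat
    using P.pow_eq_id[of x n] xP ordP by (simp flip: nat_pow_consistent)
  then have ordG: "ord x = p" using ord_unique x by blast
  have "derived G (carrier G) \<subseteq> {g \<in> carrier G. g \<otimes>\<^bsub>G\<^esub> x = x \<otimes>\<^bsub>G\<^esub> g}"
    using derived_centralizes_generator_of_normal_subgroup[OF x]
      POEC_conjugate_is_power[OF poec fin p syl comm xP ordG tors] by blast
  then have "g \<otimes>\<^bsub>G\<^esub> x = x \<otimes>\<^bsub>G\<^esub> g" if "g \<in> carrier G" for g
    using perf that by (auto simp: perfect_group_def)
  then show False
    using not_perfect_if_abelian_sylow_has_central_prime_element[OF fin p syl comm xP ordG] perf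
    by blast
qed

end
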